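(* Let $\Gamma$ and $\Gamma'$ be finite simple graphs with no isolated vertices. Then $\Gamma$ is isomorphic to $\Gamma'$ if and only if the semigroups $\operatorname{St}(\Gamma)$ and $\operatorname{St}(\Gamma')$ are isomorphic.
   Context: For a finite simple graph $\Gamma=(V,E)$, the simplices are the singletons $\{v\}$, $v\in V$, and the edges. A partial function $f:V\to V$ (acting on the right, composed left to right) is continuous if for every simplex $\sigma$ the full preimage $\sigma f^{-1}$ is a simplex or empty. $\operatorname{St}(\Gamma)$ is the semigroup of all continuous partial functions $f$ such that for every vertex $v$ the fiber $vf^{-1}$ is an edge or empty. Isomorphism of semigroups is as abstract semigroups. *)

theory Defs
  imports "HOL-Algebra.Group"
begin

locale fin_simple_graph =
  fixes V :: "'a set" and E :: "'a set set"
  assumes finite_vertices: "finite V"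
    and edges: "e \<in> E \<Longrightarrow> e \<subseteq> V \<and> card e = 2"

definition no_isolated_vertices :: "'a set \<Rightarrow> 'a set set \<Rightarrow> bool" where
  "no_isolated_vertices V E \<longleftrightarrow> (\<forall>v\<in>V. \<exists>e\<in>E. v \<in> e)"

definition graph_isomorphic ::
    "'a set \<Rightarrow> 'a set set \<Rightarrow> 'b set \<Rightarrow> 'b set set \<Rightarrow> bool" where
  "graph_isomorphic V E V' E' \<longleftrightarrow>
     (\<exists>\<phi>. bij_betw \<phi> V V' \<and> (\<forall>u\<in>V. \<forall>v\<in>V. {u, v} \<in> E \<longleftrightarrow> {\<phi> u, \<phi> v} \<in> E'))"

definition simplices :: "'a set \<Rightarrow> 'a set set \<Rightarrow> 'a set set" where
  "simplices V E = {{v} | v. v \<in> V} \<union> E"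

definition partial_functions :: "'a set \<Rightarrow> ('a \<rightharpoonup> 'a) set" where
  "partial_functions V = {f. dom f \<subseteq> V \<and> ran f \<subseteq> V}"

definition preimage :: "('a \<rightharpoonup> 'a) \<Rightarrow> 'a set \<Rightarrow> 'a set" where
  "preimage f \<sigma> = {x. \<exists>y\<in>\<sigma>. f x = Some y}"

definition continuous_pfun :: "'a set \<Rightarrow> 'a set set \<Rightarrow> ('a \<rightharpoonup> 'a) \<Rightarrow> bool" where
  "continuous_pfun V E f \<longleftrightarrow> f \<in> partial_functions V \<and>
     (\<forall>\<sigma>\<in>simplices V E. preimage f \<sigma> \<in> simplices V E \<or> preimage f \<sigma> = {})"

text \<open>
  \<open>St V E\<close> is a semigroup, in general without identity; it is represented as a
  \<^typ>\<open>'m monoid\<close> record so that HOL-Algebra's \<^const>\<open>is_iso\<close> applies to it. The field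
  \<^const>\<open>one\<close> carries no information: \<^const>\<open>hom\<close> and \<^const>\<open>iso\<close> refer only to
  carrier and multiplication (see \<open>is_iso_iff\<close> below). Partial functions act on the
  right, so the product of \<open>f\<close> and \<open>g\<close> applies \<open>f\<close> first, whereas \<open>(g \<circ>\<^sub>m f) x\<close> is
  written with functions acting on the left.
\<close>

definition St :: "'a set \<Rightarrow> 'a set set \<Rightarrow> ('a \<rightharpoonup> 'a) monoid" where
  "St V E =
     \<lparr>carrier = {f. continuous_pfun V E f \<and>
                    (\<forall>v\<in>V. preimage f {v} \<in> E \<or> preimage f {v} = {})},
      monoid.mult = (\<lambda>f g. g \<circ>\<^sub>m f),
      one = undefined\<rparr>"

lemma is_iso_iff:
  "G \<cong> H \<longleftrightarrow> (\<exists>h. bij_betw h (carrier G) (carrier H) \<and>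
     (\<forall>x\<in>carrier G. \<forall>y\<in>carrier G. h (x \<otimes>\<^bsub>G\<^esub> y) = h x \<otimes>\<^bsub>H\<^esub> h y))"
  by (auto simp: is_iso_def iso_def hom_def bij_betw_def)

lemma preimage_comp: "preimage (g \<circ>\<^sub>m f) \<sigma> = preimage f (preimage g \<sigma>)"
  by (auto simp: preimage_def map_comp_def split: option.splits)

lemma preimage_empty [simp]: "preimage f {} = {}"
  by (simp add: preimage_def)

lemma St_assoc: "(f \<otimes>\<^bsub>St V E\<^esub> g) \<otimes>\<^bsub>St V E\<^esub> h = f \<otimes>\<^bsub>St V E\<^esub> (g \<otimes>\<^bsub>St V E\<^esub> h)"
  by (auto simp: St_def map_comp_def fun_eq_iff split: option.splits)

lemma (in fin_simple_graph) St_closed: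
  assumes f: "f \<in> carrier (St V E)" and g: "g \<in> carrier (St V E)"
  shows "f \<otimes>\<^bsub>St V E\<^esub> g \<in> carrier (St V E)"
proof -
  have fc: "\<And>\<sigma>. \<sigma> \<in> simplices V E \<Longrightarrow> preimage f \<sigma> \<in> simplices V E \<or> preimage f \<sigma> = {}"
    and gc: "\<And>\<sigma>. \<sigma> \<in> simplices V E \<Longrightarrow> preimage g \<sigma> \<in> simplices V E \<or> preimage g \<sigma> = {}"
    and ff: "\<And>v. v \<in> V \<Longrightarrow> preimage f {v} \<in> E \<or> preimage f {v} = {}"
    and gf: "\<And>v. v \<in> V \<Longrightarrow> preimage g {v} \<in> E \<or> preimage g {v} = {}"
    and pf: "dom f \<subseteq> V" "ran f \<subseteq> V" "dom g \<subseteq> V" "ran g \<subseteq> V"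
    using f g by (simp_all add: St_def continuous_pfun_def partial_functions_def)
  have "g \<circ>\<^sub>m f \<in> partial_functions V"
    using pf domI ranI unfolding partial_functions_def
    by (auto simp: map_comp_Some_iff ran_def) blast+
  moreover have "preimage (g \<circ>\<^sub>m f) \<sigma> \<in> simplices V E \<or> preimage (g \<circ>\<^sub>m f) \<sigma> = {}"
    if "\<sigma> \<in> simplices V E" for \<sigma>
    using fc[of "preimage g \<sigma>"] gc[OF that] unfolding preimage_comp by auto
  moreover have "preimage f e \<in> E \<or> preimage f e = {}" if e: "e \<in> E" for e
  proof (rule ccontr)
    assume n: "\<not> ?thesis"
    with fc[of e] e obtain x where x: "preimage f e = {x}"
      by (auto simp: simplices_def)
    then obtain y where y: "y \<in> e" "f x = Some y"
      by (auto simp: preimage_def)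
    then have "x \<in> preimage f {y}" "preimage f {y} \<subseteq> {x}"
      using x unfolding preimage_def by blast+
    then have "preimage f {y} = {x}" by auto
    moreover have "y \<in> V" using y e edges by auto
    ultimately have "{x} \<in> E" using ff[of y] by simp
    then show False using edges[of "{x}"] by simp
  qed
  then have "preimage (g \<circ>\<^sub>m f) {v} \<in> E \<or> preimage (g \<circ>\<^sub>m f) {v} = {}" if "v \<in> V" for v
    using gf[OF that] by (auto simp: preimage_comp)
  ultimately show ?thesis
    by (simp add: St_def continuous_pfun_def)
qed

end

theory Submission
  imports Defs
begin

text \<open>
  In \<open>St V E\<close> the fibers over the two ends of an edge are disjoint and their union is empty or a
  simplex, so at most one of them is nonempty: the image of every element is an independent set.
  Hence an element is a matching together with an injection of its edges into an independent set
  of vertices.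

  The elements with at most one edge in their matching are the empty map, which is the zero of the
  semigroup, and the maps \<open>collapse e v\<close> sending both ends of the edge \<open>e\<close> to the vertex \<open>v\<close>.
  They multiply by the incidence relation of the graph: \<open>collapse e v\<close> followed by
  \<open>collapse d w\<close> is \<open>collapse e w\<close> if \<open>v \<in> d\<close>, and zero otherwise. If no vertex is
  isolated and there is an edge, then these elements form the least nonzero ideal (\<open>least_ideal_iff\<close>),
  a description that every isomorphism respects, so isomorphisms send collapses to collapses. Moreover,
  \<open>collapse e v\<close> and \<open>collapse d w\<close> generate the same left ideal exactly if \<open>v = w\<close>
  (\<open>collapse_left_multiple_iff\<close>), so an isomorphism induces a map \<open>\<phi>\<close> of the vertices
  (\<open>vertex_map\<close>). Equal left ideals make \<open>\<phi>\<close> injective, and it is surjective because the inverse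
  isomorphism sends collapses to collapses, too. As the product of two collapses
  records incidence, the isomorphism sends \<open>collapse e v\<close> to \<open>collapse (\<phi> ` e) (\<phi> v)\<close>
  (\<open>hom_collapse\<close>); in particular \<open>\<phi> ` e\<close> is an edge, and every edge of
  the second graph is of this form because the isomorphism reaches all collapses. Using left ideals, rather than the edges
  through a vertex, to recover \<open>v\<close> matters: the two ends of an isolated edge lie on the same edges.

  Conversely, a graph isomorphism carries the elements of one semigroup to those of the other by
  conjugation.
\<close>

section \<open>Collapsing an edge to a vertex\<close>

definition collapse :: "'a set \<Rightarrow> 'a \<Rightarrow> 'a \<rightharpoonup> 'a" where
  "collapse e v = (\<lambda>x. if x \<in> e then Some v else None)"

lemma collapse_empty [simp]: "collapse {} v = Map.empty"
  by (simp add: collapse_def)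

lemma collapse_eq_empty_iff [simp]: "collapse e v = Map.empty \<longleftrightarrow> e = {}"
  by (auto simp: collapse_def fun_eq_iff)

lemma collapse_apply [simp]: "x \<in> e \<Longrightarrow> collapse e v x = Some v"
  by (simp add: collapse_def)

lemma collapse_eq_iff:
  assumes "e \<noteq> {}"
  shows "collapse e v = collapse d w \<longleftrightarrow> e = d \<and> v = w"
  using assms unfolding collapse_def fun_eq_iff by (auto split: if_splits)

lemma preimage_collapse: "preimage (collapse e v) \<sigma> = (if v \<in> \<sigma> then e else {})"
  by (auto simp: preimage_def collapse_def split: if_splits)

lemma comp_collapse: "collapse e v \<circ>\<^sub>m f = collapse (preimage f e) v"
  by (auto simp: collapse_def preimage_def map_comp_def fun_eq_iff split: option.splits)

lemma collapse_comp:
  "f \<circ>\<^sub>m collapse e v = (case f v of None \<Rightarrow> Map.empty | Some w \<Rightarrow> collapse e w)"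
  by (auto simp: collapse_def map_comp_def fun_eq_iff split: option.splits)

lemma St_mult [simp]: "f \<otimes>\<^bsub>St V E\<^esub> g = g \<circ>\<^sub>m f"
  by (simp add: St_def)

context fin_simple_graph
begin

lemma edge_nonempty: "e \<in> E \<Longrightarrow> e \<noteq> {}"
  using edges by fastforce

lemma simplex_card:
  assumes "\<sigma> \<in> simplices V E"
  shows "finite \<sigma> \<and> card \<sigma> \<le> 2"
proof (cases "\<sigma> \<in> E")
  case True
  then show ?thesis using edges[of \<sigma>] by (simp add: card_ge_0_finite)
qed (use assms in \<open>auto simp: simplices_def\<close>)

lemma empty_map_in_St: "Map.empty \<in> carrier (St V E)"
  by (simp add: St_def continuous_pfun_def partial_functions_def preimage_def)

lemma collapse_in_St:
  assumes "e \<in> E" "v \<in> V"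
  shows "collapse e v \<in> carrier (St V E)"
proof -
  have "collapse e v \<in> partial_functions V"
    using assms edges[of e]
    by (auto simp: partial_functions_def collapse_def dom_def ran_def split: if_splits)
  then show ?thesis
    using assms(1) by (simp add: St_def continuous_pfun_def preimage_collapse simplices_def)
qed

lemma St_domain: "f \<in> carrier (St V E) \<Longrightarrow> f x = Some y \<Longrightarrow> x \<in> V"
  by (auto simp: St_def continuous_pfun_def partial_functions_def)

lemma St_range: "f \<in> carrier (St V E) \<Longrightarrow> f x = Some y \<Longrightarrow> y \<in> V"
  by (auto simp: St_def continuous_pfun_def partial_functions_def intro: ranI)

lemma St_fiber_edge:
  assumes "f \<in> carrier (St V E)" "f x = Some y"
  shows "preimage f {y} \<in> E"
proof -
  have "y \<in> V" using St_range assms .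
  moreover have "preimage f {y} \<noteq> {}" using assms(2) by (auto simp: preimage_def)
  ultimately show ?thesis using assms(1) by (auto simp: St_def)
qed

text \<open>
  The image of \<open>f\<close> is independent: two nonempty fibers over the ends of an edge would be disjoint
  edges, and their union would have four vertices, too many for a simplex.
\<close>

lemma St_preimage_edge:
  assumes f: "f \<in> carrier (St V E)" and e: "e \<in> E" and x: "f x = Some u" "u \<in> e"
  shows "preimage f e = preimage f {u}"
proof (rule ccontr)
  assume "preimage f e \<noteq> preimage f {u}"
  then obtain y w where w: "f y = Some w" "w \<in> e" "w \<noteq> u"
    using x unfolding preimage_def by auto
  have c: "card (preimage f {u}) = 2" "card (preimage f {w}) = 2"
    using St_fiber_edge[OF f] x(1) w(1) edges by blast+
  then have fin: "finite (preimage f {u})" "finite (preimage f {w})"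
    by (auto intro: card_ge_0_finite)
  have "preimage f {u} \<inter> preimage f {w} = {}"
    using w(3) by (auto simp: preimage_def)
  then have "card (preimage f {u} \<union> preimage f {w}) = 4"
    using c fin by (simp add: card_Un_disjoint)
  moreover have "preimage f {u} \<union> preimage f {w} \<subseteq> preimage f e"
    using x(2) w(2) by (auto simp: preimage_def)
  moreover have "preimage f e \<in> simplices V E \<or> preimage f e = {}"
    using f e by (auto simp: St_def continuous_pfun_def simplices_def)
  then have "finite (preimage f e) \<and> card (preimage f e) \<le> 2"
    using simplex_card by auto
  ultimately show False
    using card_mono[of "preimage f e" "preimage f {u} \<union> preimage f {w}"] by simp
qed

lemma St_preimage_edge_cases:
  assumes "f \<in> carrier (St V E)" "e \<in> E"
  shows "preimage f e \<in> E \<or> preimage f e = {}"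
proof (cases "preimage f e = {}")
  case False
  then obtain x u where "f x = Some u" "u \<in> e" by (auto simp: preimage_def)
  then show ?thesis using St_preimage_edge[OF assms] St_fiber_edge[OF assms(1)] by simp
qed simp

end

section \<open>The least nonzero ideal\<close>

locale graph_no_isolated = fin_simple_graph +
  assumes no_isolated: "no_isolated_vertices V E"
begin

lemma incident_edge: "v \<in> V \<Longrightarrow> \<exists>e\<in>E. v \<in> e"
  using no_isolated by (simp add: no_isolated_vertices_def)

text \<open>
  A nonzero \<open>g\<close> sends some vertex \<open>x\<close> to some \<open>u\<close>. Entering at \<open>x\<close> and leaving through an edge at
  \<open>u\<close>, which exists because \<open>u\<close> is not isolated, shows that every collapse is a multiple of \<open>g\<close>.
  For the converse it suffices to let \<open>g\<close> be one collapse, as a multiple of a collapse is again a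
  collapse or zero.
\<close>

lemma least_ideal_iff:
  assumes f: "f \<in> carrier (St V E)"
  shows "(f = Map.empty \<or> (\<exists>e\<in>E. \<exists>v\<in>V. f = collapse e v)) \<longleftrightarrow>
    (\<forall>g\<in>carrier (St V E). g \<noteq> Map.empty \<longrightarrow>
      (\<exists>a\<in>carrier (St V E). \<exists>b\<in>carrier (St V E). f = a \<otimes>\<^bsub>St V E\<^esub> g \<otimes>\<^bsub>St V E\<^esub> b))"
    (is "?small \<longleftrightarrow> ?multiple")
proof
  assume small: ?small
  show ?multiple
  proof (intro ballI impI)
    fix g assume g: "g \<in> carrier (St V E)" "g \<noteq> Map.empty"
    then obtain x u where x: "g x = Some u" by fastforce
    obtain d where d: "d \<in> E" "u \<in> d"
      using incident_edge[of u] St_range[OF g(1) x] by auto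
    from small show "\<exists>a\<in>carrier (St V E). \<exists>b\<in>carrier (St V E).
        f = a \<otimes>\<^bsub>St V E\<^esub> g \<otimes>\<^bsub>St V E\<^esub> b"
    proof
      assume "f = Map.empty"
      then show ?thesis using empty_map_in_St
        by (intro bexI[of _ Map.empty]) (auto simp: map_comp_def)
    next
      assume "\<exists>e\<in>E. \<exists>v\<in>V. f = collapse e v"
      then obtain e v where f: "e \<in> E" "v \<in> V" "f = collapse e v" by blast
      have "f = collapse e x \<otimes>\<^bsub>St V E\<^esub> g \<otimes>\<^bsub>St V E\<^esub> collapse d v"
        using f(3) x d(2) by (simp add: collapse_comp comp_collapse preimage_collapse)
      then show ?thesis using collapse_in_St f(1,2) d(1) St_domain[OF g(1) x] by blast
    qed
  qed
next
  assume multiple: ?multiple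
  show ?small
  proof (cases "f = Map.empty")
    case False
    then obtain x u where x: "f x = Some u" by fastforce
    (* Any collapse would do as a generator; this one exists because f is nonzero. *)
    let ?g = "collapse (preimage f {u}) u"
    have E: "preimage f {u} \<in> E" and u: "u \<in> V"
      using St_fiber_edge[OF f x] St_range[OF f x] .
    then have "?g \<in> carrier (St V E)" "?g \<noteq> Map.empty"
      using collapse_in_St edge_nonempty by auto
    then obtain a b where ab: "a \<in> carrier (St V E)" "b \<in> carrier (St V E)"
      "f = a \<otimes>\<^bsub>St V E\<^esub> ?g \<otimes>\<^bsub>St V E\<^esub> b"
      using multiple by blast
    then have eq: "f = b \<circ>\<^sub>m collapse (preimage a (preimage f {u})) u"
      by (simp add: comp_collapse)
    with False obtain w where "b u = Some w" by (fastforce simp: collapse_comp split: option.splits)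
    then have "f = collapse (preimage a (preimage f {u})) w"
      using eq by (simp add: collapse_comp)
    then show ?thesis
      using False St_preimage_edge_cases[OF ab(1) E] St_range[OF ab(2) \<open>b u = Some w\<close>] by auto
  qed simp
qed

text \<open>
  A factor on the left can replace the edge of a collapse by any other edge, but it cannot move the
  vertex.
\<close>

lemma collapse_left_multiple_iff:
  assumes "e \<in> E" "d \<in> E" "v \<in> V" "w \<in> V"
  shows "(\<exists>s\<in>carrier (St V E). collapse e v = s \<otimes>\<^bsub>St V E\<^esub> collapse d w) \<longleftrightarrow> v = w"
proof
  assume "\<exists>s\<in>carrier (St V E). collapse e v = s \<otimes>\<^bsub>St V E\<^esub> collapse d w"
  then show "v = w"
    using edge_nonempty[OF assms(1)] by (auto simp: comp_collapse collapse_eq_iff)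
next
  assume "v = w"
  obtain x where "x \<in> d" using edge_nonempty assms(2) by blast
  then have "collapse e v = collapse e x \<otimes>\<^bsub>St V E\<^esub> collapse d w" "x \<in> V"
    using \<open>v = w\<close> edges assms(2) by (auto simp: comp_collapse preimage_collapse)
  then show "\<exists>s\<in>carrier (St V E). collapse e v = s \<otimes>\<^bsub>St V E\<^esub> collapse d w"
    using collapse_in_St assms(1) by blast
qed

end

section \<open>From semigroup isomorphisms to graph isomorphisms\<close>

locale St_isomorphism =
  src: graph_no_isolated V E + tgt: graph_no_isolated V' E'
  for V :: "'a set" and E and V' :: "'b set" and E' +
  fixes h :: "('a \<rightharpoonup> 'a) \<Rightarrow> ('b \<rightharpoonup> 'b)"
  assumes iso: "h \<in> iso (St V E) (St V' E')"
begin

lemma hom_closed: "x \<in> carrier (St V E) \<Longrightarrow> h x \<in> carrier (St V' E')"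
  using iso by (auto simp: iso_def hom_def)

lemma hom_mult: "x \<in> carrier (St V E) \<Longrightarrow> y \<in> carrier (St V E) \<Longrightarrow>
    h (x \<otimes>\<^bsub>St V E\<^esub> y) = h x \<otimes>\<^bsub>St V' E'\<^esub> h y"
  using iso by (simp add: iso_def hom_def)

lemma hom_surj: "y \<in> carrier (St V' E') \<Longrightarrow> \<exists>x\<in>carrier (St V E). y = h x"
  using iso by (auto simp: iso_def bij_betw_def)

lemma hom_eq_iff: "x \<in> carrier (St V E) \<Longrightarrow> y \<in> carrier (St V E) \<Longrightarrow> h x = h y \<longleftrightarrow> x = y"
  using iso by (auto simp: iso_def bij_betw_def inj_on_eq_iff)

lemma inverse: "St_isomorphism V' E' V E (inv_into (carrier (St V E)) h)"
proof -
  have "inv_into (carrier (St V E)) h \<in> iso (St V' E') (St V E)"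
  proof (rule isoI)
    have bij: "bij_betw h (carrier (St V E)) (carrier (St V' E'))"
      using iso by (simp add: iso_def)
    then show "bij_betw (inv_into (carrier (St V E)) h) (carrier (St V' E')) (carrier (St V E))"
      by (rule bij_betw_inv_into)
    show "inv_into (carrier (St V E)) h \<in> hom (St V' E') (St V E)"
    proof (rule homI)
      fix x y assume "x \<in> carrier (St V' E')" "y \<in> carrier (St V' E')"
      then obtain a b where ab: "a \<in> carrier (St V E)" "b \<in> carrier (St V E)" "x = h a" "y = h b"
        using hom_surj by meson
      then show "inv_into (carrier (St V E)) h (x \<otimes>\<^bsub>St V' E'\<^esub> y) =
        inv_into (carrier (St V E)) h x \<otimes>\<^bsub>St V E\<^esub> inv_into (carrier (St V E)) h y"
        using bij hom_mult[OF ab(1,2)] src.St_closed[OF ab(1,2)]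
        by (metis bij_betw_inv_into_left)
    qed (use bij in \<open>auto simp: bij_betw_def inv_into_into\<close>)
  qed
  then show ?thesis by unfold_locales
qed

lemma hom_zero: "h Map.empty = Map.empty"
proof -
  obtain z where z: "z \<in> carrier (St V E)" "Map.empty = h z"
    using hom_surj[OF tgt.empty_map_in_St] by blast
  have "Map.empty = z \<otimes>\<^bsub>St V E\<^esub> Map.empty"
    by (simp add: map_comp_def fun_eq_iff split: option.splits)
  then have "h Map.empty = h z \<otimes>\<^bsub>St V' E'\<^esub> h Map.empty"
    using hom_mult z(1) src.empty_map_in_St by metis
  then show ?thesis using z(2)[symmetric] by simp
qed

lemma hom_eq_empty_iff: "x \<in> carrier (St V E) \<Longrightarrow> h x = Map.empty \<longleftrightarrow> x = Map.empty"
  using hom_zero hom_eq_iff src.empty_map_in_St by metis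

lemma hom_collapse_ex:
  assumes "e \<in> E" "v \<in> V"
  shows "\<exists>d\<in>E'. \<exists>w\<in>V'. h (collapse e v) = collapse d w"
proof -
  let ?x = "collapse e v"
  have x: "?x \<in> carrier (St V E)" using src.collapse_in_St assms .
  have "\<exists>a\<in>carrier (St V' E'). \<exists>b\<in>carrier (St V' E').
      h ?x = a \<otimes>\<^bsub>St V' E'\<^esub> g \<otimes>\<^bsub>St V' E'\<^esub> b"
    if g: "g \<in> carrier (St V' E')" "g \<noteq> Map.empty" for g
  proof -
    obtain y where y: "y \<in> carrier (St V E)" "g = h y" using hom_surj g(1) by blast
    then have "y \<noteq> Map.empty" using g(2) hom_zero by auto
    then obtain a b where ab: "a \<in> carrier (St V E)" "b \<in> carrier (St V E)"
      "?x = a \<otimes>\<^bsub>St V E\<^esub> y \<otimes>\<^bsub>St V E\<^esub> b"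
      using src.least_ideal_iff[OF x] y(1) assms by blast
    then have "h ?x = h a \<otimes>\<^bsub>St V' E'\<^esub> g \<otimes>\<^bsub>St V' E'\<^esub> h b"
      using hom_mult src.St_closed y by metis
    then show ?thesis using hom_closed ab(1,2) by blast
  qed
  then have "h ?x = Map.empty \<or> (\<exists>d\<in>E'. \<exists>w\<in>V'. h ?x = collapse d w)"
    using tgt.least_ideal_iff[OF hom_closed[OF x]] by blast
  then show ?thesis
    using hom_eq_empty_iff[OF x] src.edge_nonempty[OF assms(1)] by simp
qed

text \<open>
  All edges \<open>e\<close> lead to the same vertex \<open>w\<close> (\<open>hom_collapse_target\<close>), since collapses to \<open>v\<close> are
  left multiples of each other.
\<close>

definition vertex_map :: "'a \<Rightarrow> 'b" where
  "vertex_map v = (SOME w. \<exists>e\<in>E. \<exists>d\<in>E'. w \<in> V' \<and> h (collapse e v) = collapse d w)"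

lemma hom_left_multiple_iff:
  assumes "x \<in> carrier (St V E)" "y \<in> carrier (St V E)"
  shows "(\<exists>s\<in>carrier (St V' E'). h x = s \<otimes>\<^bsub>St V' E'\<^esub> h y) \<longleftrightarrow>
    (\<exists>s\<in>carrier (St V E). x = s \<otimes>\<^bsub>St V E\<^esub> y)"
proof -
  have "h x = h s \<otimes>\<^bsub>St V' E'\<^esub> h y \<longleftrightarrow> x = s \<otimes>\<^bsub>St V E\<^esub> y" if "s \<in> carrier (St V E)" for s
    using hom_mult[OF that assms(2)] hom_eq_iff[OF assms(1) src.St_closed[OF that assms(2)]] by simp
  then show ?thesis using hom_surj hom_closed by blast
qed

lemma hom_collapse_target_eq_iff:
  assumes "e \<in> E" "d \<in> E" "v \<in> V" "w \<in> V" "e' \<in> E'" "d' \<in> E'" "v' \<in> V'" "w' \<in> V'"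
    and "h (collapse e v) = collapse e' v'" "h (collapse d w) = collapse d' w'"
  shows "v' = w' \<longleftrightarrow> v = w"
  using hom_left_multiple_iff[OF src.collapse_in_St src.collapse_in_St, of e v d w]
    src.collapse_left_multiple_iff[of e d v w] tgt.collapse_left_multiple_iff[of e' d' v' w'] assms
  by metis

lemma vertex_map_collapse:
  assumes "v \<in> V"
  shows "\<exists>e\<in>E. \<exists>d\<in>E'. vertex_map v \<in> V' \<and> h (collapse e v) = collapse d (vertex_map v)"
proof -
  obtain e where "e \<in> E" using src.incident_edge assms by blast
  then show ?thesis
    unfolding vertex_map_def using hom_collapse_ex[OF _ assms]
    by (intro someI_ex[where P = "\<lambda>w. \<exists>e\<in>E. \<exists>d\<in>E'. w \<in> V' \<and> h (collapse e v) = collapse d w"])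
      blast
qed

lemma hom_collapse_target:
  assumes "e \<in> E" "v \<in> V"
  shows "\<exists>d\<in>E'. h (collapse e v) = collapse d (vertex_map v)"
proof -
  obtain d w where dw: "d \<in> E'" "w \<in> V'" "h (collapse e v) = collapse d w"
    using hom_collapse_ex[OF assms] by blast
  moreover have "w = vertex_map v"
    using vertex_map_collapse[OF assms(2)] hom_collapse_target_eq_iff assms dw by metis
  ultimately show ?thesis by blast
qed

lemma vertex_map_bij: "bij_betw vertex_map V V'"
proof (rule bij_betwI')
  fix v w assume "v \<in> V" "w \<in> V"
  then show "vertex_map v = vertex_map w \<longleftrightarrow> v = w"
    using vertex_map_collapse hom_collapse_target_eq_iff by metis
next
  show "vertex_map v \<in> V'" if "v \<in> V" for v using vertex_map_collapse[OF that] by blast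
next
  fix w assume w: "w \<in> V'"
  then obtain d where d: "d \<in> E'" using tgt.incident_edge by blast
  interpret inv: St_isomorphism V' E' V E "inv_into (carrier (St V E)) h" by (rule inverse)
  have dw: "collapse d w \<in> carrier (St V' E')" using tgt.collapse_in_St d w .
  obtain e v where ev: "e \<in> E" "v \<in> V" "inv_into (carrier (St V E)) h (collapse d w) = collapse e v"
    using inv.hom_collapse_ex[OF d w] by blast
  have "h (collapse e v) = collapse d w"
    using f_inv_into_f[of "collapse d w" h "carrier (St V E)"] hom_surj[OF dw] ev(3) by auto
  then have "w = vertex_map v"
    using hom_collapse_target[OF ev(1,2)] tgt.edge_nonempty[OF d] by (auto simp: collapse_eq_iff)
  then show "\<exists>v\<in>V. w = vertex_map v" using ev(2) by blast
qed

text \<open>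
  A vertex \<open>u\<close> lies on \<open>e\<close> exactly if some collapse to \<open>u\<close> followed by \<open>collapse e v\<close> is
  nonzero, and isomorphisms preserve nonzero products.
\<close>

lemma hom_collapse:
  assumes "e \<in> E" "v \<in> V"
  shows "h (collapse e v) = collapse (vertex_map ` e) (vertex_map v)" and "vertex_map ` e \<in> E'"
proof -
  obtain d where d: "d \<in> E'" "h (collapse e v) = collapse d (vertex_map v)"
    using hom_collapse_target[OF assms] by blast
  have "vertex_map u \<in> d \<longleftrightarrow> u \<in> e" if u: "u \<in> V" for u
  proof -
    obtain c where c: "c \<in> E'" "h (collapse e u) = collapse c (vertex_map u)"
      using hom_collapse_target[OF assms(1) u] by blast
    have in_St: "collapse e u \<in> carrier (St V E)" "collapse e v \<in> carrier (St V E)"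
      using src.collapse_in_St assms u by auto
    have "collapse e u \<otimes>\<^bsub>St V E\<^esub> collapse e v = Map.empty \<longleftrightarrow>
        h (collapse e u) \<otimes>\<^bsub>St V' E'\<^esub> h (collapse e v) = Map.empty"
      using hom_eq_empty_iff[OF src.St_closed[OF in_St]] hom_mult[OF in_St] by metis
    then show ?thesis
      using c d src.edge_nonempty[OF assms(1)] tgt.edge_nonempty[OF c(1)]
      by (simp add: comp_collapse preimage_collapse split: if_splits)
  qed
  moreover have "d \<subseteq> vertex_map ` V" "e \<subseteq> V"
    using vertex_map_bij tgt.edges[OF d(1)] src.edges[OF assms(1)] by (auto simp: bij_betw_def)
  ultimately have "d = vertex_map ` e" by blast
  then show "h (collapse e v) = collapse (vertex_map ` e) (vertex_map v)" "vertex_map ` e \<in> E'"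
    using d by simp_all
qed

lemma graph_isomorphic: "graph_isomorphic V E V' E'"
proof -
  have "{u, v} \<in> E \<longleftrightarrow> {vertex_map u, vertex_map v} \<in> E'" if uv: "u \<in> V" "v \<in> V" for u v
  proof
    assume "{u, v} \<in> E"
    then show "{vertex_map u, vertex_map v} \<in> E'" using hom_collapse(2)[of "{u, v}"] uv by force
  next
    let ?d = "{vertex_map u, vertex_map v}"
    assume d: "?d \<in> E'"
    interpret inv: St_isomorphism V' E' V E "inv_into (carrier (St V E)) h" by (rule inverse)
    have w: "vertex_map v \<in> V'" using vertex_map_bij uv(2) by (auto simp: bij_betw_def)
    have dw: "collapse ?d (vertex_map v) \<in> carrier (St V' E')" using tgt.collapse_in_St d w .
    obtain e x where ex: "e \<in> E" "x \<in> V"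
      "inv_into (carrier (St V E)) h (collapse ?d (vertex_map v)) = collapse e x"
      using inv.hom_collapse_ex[OF d w] by blast
    have "h (collapse e x) = collapse ?d (vertex_map v)"
      using f_inv_into_f[of "collapse ?d (vertex_map v)" h "carrier (St V E)"] hom_surj[OF dw] ex(3)
      by auto
    then have "vertex_map ` e = vertex_map ` {u, v}"
      using hom_collapse(1)[OF ex(1,2)] src.edge_nonempty[OF ex(1)] by (simp add: collapse_eq_iff)
    then have "e = {u, v}"
      using inj_on_image_eq_iff[of vertex_map V e "{u, v}"] vertex_map_bij src.edges[OF ex(1)] uv
      by (auto simp: bij_betw_def)
    then show "{u, v} \<in> E" using ex(1) by simp
  qed
  then show ?thesis unfolding graph_isomorphic_def using vertex_map_bij by blast
qed

end

section \<open>From graph isomorphisms to semigroup isomorphisms\<close>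

text \<open>
  The inverse \<open>\<psi>\<close> is a parameter so that the two graphs play symmetric roles and every lemma
  applies to both directions.
\<close>

locale graph_isomorphism =
  src: fin_simple_graph V E + tgt: fin_simple_graph V' E'
  for V :: "'a set" and E and V' :: "'b set" and E' +
  fixes \<phi> :: "'a \<Rightarrow> 'b" and \<psi> :: "'b \<Rightarrow> 'a"
  assumes fwd: "x \<in> V \<Longrightarrow> \<phi> x \<in> V'" "x \<in> V \<Longrightarrow> \<psi> (\<phi> x) = x"
    and bwd: "y \<in> V' \<Longrightarrow> \<psi> y \<in> V" "y \<in> V' \<Longrightarrow> \<phi> (\<psi> y) = y"
    and edge_to: "e \<in> E \<Longrightarrow> \<phi> ` e \<in> E'"
    and edge_from: "d \<in> E' \<Longrightarrow> \<psi> ` d \<in> E"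
begin

lemma inverse: "graph_isomorphism V' E' V E \<psi> \<phi>"
  by unfold_locales (simp_all add: fwd bwd edge_to edge_from)

definition conjugate :: "('a \<rightharpoonup> 'a) \<Rightarrow> 'b \<rightharpoonup> 'b" where
  "conjugate f = (\<lambda>y. if y \<in> V' then map_option \<phi> (f (\<psi> y)) else None)"

lemma preimage_conjugate:
  assumes "f \<in> partial_functions V" "\<tau> \<subseteq> V'"
  shows "preimage (conjugate f) \<tau> = \<phi> ` preimage f (\<psi> ` \<tau>)"
proof (intro equalityI subsetI)
  have V: "x \<in> V \<and> w \<in> V" if "f x = Some w" for x w
    using assms(1) that by (auto simp: partial_functions_def intro: ranI)
  show "y \<in> \<phi> ` preimage f (\<psi> ` \<tau>)" if y: "y \<in> preimage (conjugate f) \<tau>" for y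
  proof -
    obtain w where w: "y \<in> V'" "f (\<psi> y) = Some w" "\<phi> w \<in> \<tau>"
      using y by (auto simp: preimage_def conjugate_def split: if_splits)
    then have "w = \<psi> (\<phi> w)" using V fwd(2) by simp
    then have "\<psi> y \<in> preimage f (\<psi> ` \<tau>)" using w unfolding preimage_def by auto
    then show ?thesis using bwd(2)[OF w(1)] by force
  qed
  show "y \<in> preimage (conjugate f) \<tau>" if y: "y \<in> \<phi> ` preimage f (\<psi> ` \<tau>)" for y
  proof -
    obtain x t where x: "y = \<phi> x" "f x = Some (\<psi> t)" "t \<in> \<tau>"
      using y by (auto simp: preimage_def)
    then show ?thesis using V[OF x(2)] fwd bwd(2) assms(2)
      by (auto simp: preimage_def conjugate_def)
  qed
qed

lemma simplex_to: "\<sigma> \<in> simplices V E \<Longrightarrow> \<phi> ` \<sigma> \<in> simplices V' E'"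
  using fwd(1) edge_to by (auto simp: simplices_def)

lemma simplex_from: "\<tau> \<in> simplices V' E' \<Longrightarrow> \<psi> ` \<tau> \<in> simplices V E"
  using bwd(1) edge_from by (auto simp: simplices_def)

lemma conjugate_in_St:
  assumes f: "f \<in> carrier (St V E)"
  shows "conjugate f \<in> carrier (St V' E')"
proof -
  have pf: "f \<in> partial_functions V" using f by (simp add: St_def continuous_pfun_def)
  have "conjugate f \<in> partial_functions V'"
    using pf fwd(1) unfolding partial_functions_def
    by (auto simp: dom_def ran_def conjugate_def split: if_splits)
  moreover have "preimage (conjugate f) \<tau> \<in> simplices V' E' \<or> preimage (conjugate f) \<tau> = {}"
    if \<tau>: "\<tau> \<in> simplices V' E'" for \<tau>
  proof -
    have "\<tau> \<subseteq> V'" using \<tau> tgt.edges by (auto simp: simplices_def)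
    then have "preimage (conjugate f) \<tau> = \<phi> ` preimage f (\<psi> ` \<tau>)"
      using preimage_conjugate[OF pf] by blast
    moreover have "preimage f (\<psi> ` \<tau>) \<in> simplices V E \<or> preimage f (\<psi> ` \<tau>) = {}"
      using f simplex_from[OF \<tau>] by (simp add: St_def continuous_pfun_def)
    ultimately show ?thesis using simplex_to by auto
  qed
  moreover have "preimage (conjugate f) {w} \<in> E' \<or> preimage (conjugate f) {w} = {}"
    if w: "w \<in> V'" for w
  proof -
    have "preimage (conjugate f) {w} = \<phi> ` preimage f {\<psi> w}"
      using preimage_conjugate[OF pf, of "{w}"] w by simp
    moreover have "preimage f {\<psi> w} \<in> E \<or> preimage f {\<psi> w} = {}"
      using f bwd(1)[OF w] by (simp add: St_def)
    ultimately show ?thesis using edge_to by auto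
  qed
  ultimately show ?thesis by (simp add: St_def continuous_pfun_def)
qed

lemma conjugate_comp:
  assumes "ran f \<subseteq> V"
  shows "conjugate (g \<circ>\<^sub>m f) = conjugate g \<circ>\<^sub>m conjugate f"
proof
  show "conjugate (g \<circ>\<^sub>m f) y = (conjugate g \<circ>\<^sub>m conjugate f) y" for y
    using assms fwd by (cases "f (\<psi> y)") (auto simp: conjugate_def map_comp_def dest: ranI)
qed

lemma conjugate_inverse:
  assumes "f \<in> carrier (St V E)"
  shows "graph_isomorphism.conjugate V \<psi> \<phi> (conjugate f) = f"
proof
  interpret inv: graph_isomorphism V' E' V E \<psi> \<phi> by (rule inverse)
  show "inv.conjugate (conjugate f) x = f x" for x
    using src.St_domain[OF assms, of x] src.St_range[OF assms, of x] fwd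
    by (cases "f x") (auto simp: inv.conjugate_def conjugate_def)
qed

lemma St_iso: "St V E \<cong> St V' E'"
proof -
  interpret inv: graph_isomorphism V' E' V E \<psi> \<phi> by (rule inverse)
  have "bij_betw conjugate (carrier (St V E)) (carrier (St V' E'))"
    by (rule bij_betw_byWitness[where f' = inv.conjugate])
      (auto simp: conjugate_inverse inv.conjugate_inverse conjugate_in_St inv.conjugate_in_St)
  moreover have "conjugate (f \<otimes>\<^bsub>St V E\<^esub> g) = conjugate f \<otimes>\<^bsub>St V' E'\<^esub> conjugate g"
    if "f \<in> carrier (St V E)" for f g
    using conjugate_comp that by (simp add: St_def continuous_pfun_def partial_functions_def)
  ultimately show ?thesis unfolding is_iso_iff by blast
qed

end

lemma graph_isomorphic_imp_St_iso:
  assumes "fin_simple_graph V E" "fin_simple_graph V' E'" "graph_isomorphic V E V' E'"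
  shows "St V E \<cong> St V' E'"
proof -
  interpret src: fin_simple_graph V E by fact
  interpret tgt: fin_simple_graph V' E' by fact
  obtain \<phi> where bij: "bij_betw \<phi> V V'"
    and adj: "\<And>u v. u \<in> V \<Longrightarrow> v \<in> V \<Longrightarrow> {u, v} \<in> E \<longleftrightarrow> {\<phi> u, \<phi> v} \<in> E'"
    using assms(3) unfolding graph_isomorphic_def by blast
  define \<psi> where "\<psi> = inv_into V \<phi>"
  have fwd: "\<phi> x \<in> V'" "\<psi> (\<phi> x) = x" if "x \<in> V" for x
    using bij that by (auto simp: \<psi>_def bij_betw_def)
  have bwd: "\<psi> y \<in> V" "\<phi> (\<psi> y) = y" if "y \<in> V'" for y
    using bij that by (auto simp: \<psi>_def bij_betw_def inv_into_into f_inv_into_f)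
  have "graph_isomorphism V E V' E' \<phi> \<psi>"
  proof unfold_locales
    fix e assume e: "e \<in> E"
    then obtain u v where "e = {u, v}" "u \<in> V" "v \<in> V"
      using src.edges[OF e] by (auto simp: card_2_iff)
    then show "\<phi> ` e \<in> E'" using e adj by simp
  next
    fix d assume d: "d \<in> E'"
    then obtain u v where "d = {u, v}" "u \<in> V'" "v \<in> V'"
      using tgt.edges[OF d] by (auto simp: card_2_iff)
    then show "\<psi> ` d \<in> E" using d adj[of "\<psi> u" "\<psi> v"] bwd by simp
  qed (use fwd bwd in auto)
  then show ?thesis by (rule graph_isomorphism.St_iso)
qed

theorem theorem19p3:
  fixes V :: "'a set" and E :: "'a set set"
    and V' :: "'b set" and E' :: "'b set set"
  assumes "fin_simple_graph V E" and "no_isolated_vertices V E"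
    and "fin_simple_graph V' E'" and "no_isolated_vertices V' E'"
  shows "graph_isomorphic V E V' E' \<longleftrightarrow> St V E \<cong> St V' E'"
proof
  assume "graph_isomorphic V E V' E'"
  then show "St V E \<cong> St V' E'" using graph_isomorphic_imp_St_iso assms by blast
next
  assume "St V E \<cong> St V' E'"
  then obtain h where "h \<in> iso (St V E) (St V' E')" by (auto simp: is_iso_def)
  then have "St_isomorphism V E V' E' h"
    using assms by (intro St_isomorphism.intro St_isomorphism_axioms.intro
        graph_no_isolated.intro graph_no_isolated_axioms.intro)
  then show "graph_isomorphic V E V' E'" by (rule St_isomorphism.graph_isomorphic)
qed

end
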